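(* Let $F:\mathcal{S}^{n\times n}\to\mathbb{R}$ be twice continuously differentiable, let $\alpha,\beta\in\mathbb{R}$ with $\alpha<\beta$, and let $k\in\{1,\dots,7\}$. Let the interval $\mathcal{I}_k\subseteq\mathbb{R}$ and the map $\boldsymbol{G}_k:\mathcal{S}^{n\times n}\to\mathcal{S}^{n\times n}$ be given by: \begin{itemize} \item $\mathcal{I}_1=(\alpha,+\infty)$, $\boldsymbol{G}_1(\boldsymbol{X})=e^{\boldsymbol{X}}+\alpha \boldsymbol{I}$; \item $\mathcal{I}_2=(-\infty,\alpha)$, $\boldsymbol{G}_2(\boldsymbol{X})=-e^{\boldsymbol{X}}+\alpha \boldsymbol{I}$; \item $\mathcal{I}_3=[\alpha,+\infty)$, $\boldsymbol{G}_3(\boldsymbol{X})=\boldsymbol{X}^2+\alpha \boldsymbol{I}$; \item $\mathcal{I}_4=(-\infty,\alpha]$, $\boldsymbol{G}_4(\boldsymbol{X})=-\boldsymbol{X}^2+\alpha \boldsymbol{I}$; \item $\mathcal{I}_5=(\alpha,\beta]$, $\boldsymbol{G}_5(\boldsymbol{X})=(\beta-\alpha)(\boldsymbol{I}+\boldsymbol{X}^2)^{-1}+\alpha \boldsymbol{I}$; \item $\mathcal{I}_6=[\alpha,\beta)$, $\boldsymbol{G}_6(\boldsymbol{X})=(\alpha-\beta)(\boldsymbol{I}+\boldsymbol{X}^2)^{-1}+\beta \boldsymbol{I}$; \item $\mathcal{I}_7=(\alpha,\beta)$, $\boldsymbol{G}_7(\boldsymbol{X})=\boldsymbol{Q}\boldsymbol{G}_7(\boldsymbol{D})\boldsymbol{Q}^\top$,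 where $\boldsymbol{X}=\boldsymbol{Q}\boldsymbol{D}\boldsymbol{Q}^\top$ is a spectral decomposition and the scalar function is $G_7(x)=\left(\frac{\beta-\alpha}{\pi}\right)\arctan(x)+\frac{\beta+\alpha}{2}$. \end{itemize} If there exists $$\boldsymbol{X}^*\in\operatorname{argmin}\{F(\boldsymbol{X})\;|\;\lambda_j(\boldsymbol{X})\in\mathcal{I}_k,\ j=1,\dots,n,\ \boldsymbol{X}\in\mathcal{S}^{n\times n}\},$$ then there exists $$\boldsymbol{U}^*\in\operatorname{argmin}\{F(\boldsymbol{G}_k(\boldsymbol{U}))\;|\;\boldsymbol{U}\in\mathcal{S}^{n\times n}\}$$ such that $F(\boldsymbol{X}^* )=F(\boldsymbol{G}_k(\boldsymbol{U}^* ))$.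
   Context: $\mathcal{S}^{n\times n}$ is the space of $n\times n$ real symmetric matrices; $\lambda_j(\boldsymbol{X})$ is the $j$-th largest eigenvalue of $\boldsymbol{X}$; $\boldsymbol{I}$ is the identity matrix. For a scalar function $G:\mathbb{R}\to\mathbb{R}$ and $\boldsymbol{X}\in\mathcal{S}^{n\times n}$ with spectral decomposition $\boldsymbol{X}=\boldsymbol{Q}\boldsymbol{D}\boldsymbol{Q}^\top$ ($\boldsymbol{Q}$ orthogonal, $\boldsymbol{D}$ diagonal), the matrix function defined by $G$ is $\boldsymbol{G}(\boldsymbol{X})=\boldsymbol{Q}\boldsymbol{G}(\boldsymbol{D})\boldsymbol{Q}^\top$ with $\boldsymbol{G}(\boldsymbol{D})=\operatorname{Diag}(G(D_{11}),\dots,G(D_{nn}))$; its value does not depend on the chosen spectral decomposition. The matrix exponential $e^{\boldsymbol{X}}$ is the matrix function of $x\mapsto e^x$. *)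

theory Defs
  imports "HOL-Analysis.Analysis" "HOL-Computational_Algebra.Polynomial"
begin

text \<open>The space of real symmetric matrices is a linear subspace of the space of
  all real square matrices; functions on it are functions on all matrices of which only the
  values on the subspace are used.\<close>

definition sym_matrices :: "(real^'n^'n) set" where
  "sym_matrices = {X. transpose X = X}"

definition diag_matrix :: "real^'n \<Rightarrow> real^'n^'n" where
  "diag_matrix d = (\<chi> i j. if i = j then d $ i else 0)"

definition char_poly_matrix :: "real^'n^'n \<Rightarrow> real poly" where
  "char_poly_matrix A = det (\<chi> i j. (if i = j then [:0, 1:] else 0) - [:A $ i $ j:])"

text \<open>The \<open>j\<close>-th largest eigenvalue, counted with multiplicity and starting from \<open>j = 1\<close>. For
  symmetric \<open>X\<close> all roots of the characteristic polynomial are real, so the list has length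
  \<open>CARD('n)\<close> and the value is meaningful for \<open>1 \<le> j \<le> CARD('n)\<close>.\<close>

definition eigenvalue_nth :: "nat \<Rightarrow> real^'n^'n \<Rightarrow> real" where
  "eigenvalue_nth j X = rev (sorted_list_of_multiset (proots (char_poly_matrix X))) ! (j - 1)"

definition spectral_decomposition :: "real^'n^'n \<Rightarrow> real^'n^'n \<Rightarrow> real^'n \<Rightarrow> bool" where
  "spectral_decomposition X Q d \<longleftrightarrow>
     orthogonal_matrix Q \<and> X = Q ** diag_matrix d ** transpose Q"

text \<open>The definite description is legitimate on symmetric matrices: a spectral decomposition
  exists and the value does not depend on its choice.\<close>

definition matrix_function :: "(real \<Rightarrow> real) \<Rightarrow> real^'n^'n \<Rightarrow> real^'n^'n" where
  "matrix_function g X =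
     (THE Y. \<exists>Q d. spectral_decomposition X Q d \<and>
                   Y = Q ** diag_matrix (\<chi> i. g (d $ i)) ** transpose Q)"

text \<open>Twice continuous differentiability on a linear subspace \<open>S\<close>. The derivatives are taken
  within \<open>S\<close>; they are represented by continuous linear maps on the ambient space, of which only the
  restriction to \<open>S\<close> is determined. Any derivative on \<open>S\<close> extends to the ambient space by
  composition with a linear projection onto \<open>S\<close>.\<close>

definition C2_on_subspace :: "'a::euclidean_space set \<Rightarrow> ('a \<Rightarrow> real) \<Rightarrow> bool" where
  "C2_on_subspace S f \<longleftrightarrow>
     (\<exists>(f' :: 'a \<Rightarrow> 'a \<Rightarrow>\<^sub>L real) (f'' :: 'a \<Rightarrow> 'a \<Rightarrow>\<^sub>L 'a \<Rightarrow>\<^sub>L real).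
        (\<forall>x\<in>S. (f has_derivative blinfun_apply (f' x)) (at x within S)) \<and>
        (\<forall>x\<in>S. (f' has_derivative blinfun_apply (f'' x)) (at x within S)) \<and>
        continuous_on S f'')"

text \<open>Both of the following are meaningful for \<open>1 \<le> k \<le> 7\<close> only.\<close>

definition interval_k :: "nat \<Rightarrow> real \<Rightarrow> real \<Rightarrow> real set" where
  "interval_k k \<alpha> \<beta> =
    (if k = 1 then {\<alpha><..}
     else if k = 2 then {..<\<alpha>}
     else if k = 3 then {\<alpha>..}
     else if k = 4 then {..\<alpha>}
     else if k = 5 then {\<alpha><..\<beta>}
     else if k = 6 then {\<alpha>..<\<beta>}
     else if k = 7 then {\<alpha><..<\<beta>}
     else undefined)"

definition G_map :: "nat \<Rightarrow> real \<Rightarrow> real \<Rightarrow> real^'n^'n \<Rightarrow> real^'n^'n" where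
  "G_map k \<alpha> \<beta> X =
    (if k = 1 then matrix_function exp X + \<alpha> *\<^sub>R mat 1
     else if k = 2 then - matrix_function exp X + \<alpha> *\<^sub>R mat 1
     else if k = 3 then X ** X + \<alpha> *\<^sub>R mat 1
     else if k = 4 then - (X ** X) + \<alpha> *\<^sub>R mat 1
     else if k = 5 then (\<beta> - \<alpha>) *\<^sub>R matrix_inv (mat 1 + X ** X) + \<alpha> *\<^sub>R mat 1
     else if k = 6 then (\<alpha> - \<beta>) *\<^sub>R matrix_inv (mat 1 + X ** X) + \<beta> *\<^sub>R mat 1
     else if k = 7 then matrix_function (\<lambda>x. (\<beta> - \<alpha>) / pi * arctan x + (\<beta> + \<alpha>) / 2) X
     else undefined)"

end

theory Submission
  imports Defs
begin

text \<open>Each of the seven matrix maps acts on a spectral decomposition \<open>X = Q D Q\<^sup>T\<close> by applying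
  a scalar function to the diagonal of \<open>D\<close> and keeping the orthogonal factor
  (\<open>G_map_spectral\<close>). The scalar function is chosen so that it maps the real line onto the
  interval \<open>interval_k k \<alpha> \<beta>\<close> (\<open>range_G_scalar\<close>). Hence the matrix map takes the symmetric
  matrices onto the symmetric matrices with all eigenvalues in that interval
  (\<open>G_map_image_sym_matrices\<close>): a feasible \<open>X = Q D Q\<^sup>T\<close> is the image of \<open>Q E Q\<^sup>T\<close> for any
  diagonal \<open>E\<close> whose entries are preimages of those of \<open>D\<close>. Consequently \<open>F\<close> on the feasible
  set and \<open>F \<circ> G_map k \<alpha> \<beta>\<close> on the symmetric matrices take the same values, and any
  preimage of a constrained minimiser is an unconstrained one with the same value.

  Three facts about real symmetric matrices carry the argument: the spectral theorem
  (\<open>spectral_decomposition_exists\<close>), the fact that the ordered eigenvalues read off the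
  characteristic polynomial are the diagonal entries of any spectral decomposition
  (\<open>eigenvalue_nth_range\<close>), and the independence of a matrix function from the
  decomposition used to compute it (\<open>spectral_function_unique\<close>).\<close>

section \<open>The spectral theorem\<close>

text \<open>A maximiser \<open>x\<close> of the Rayleigh quotient on the unit sphere of \<open>S\<close>, with maximal value \<open>c\<close>,
  is an eigenvector: the form \<open>q y = c (y \<bullet> y) - y \<bullet> f y\<close> is nonnegative on \<open>S\<close> and vanishes
  at \<open>x\<close>, so its derivative at \<open>x\<close> in the direction \<open>c x - f x\<close>, which is twice the squared norm
  of that vector, must vanish.\<close>

lemma self_adjoint_eigenvector:
  fixes f :: "'a::euclidean_space \<Rightarrow> 'a"
  assumes lin: "linear f" and adj: "\<And>x y. f x \<bullet> y = x \<bullet> f y"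
    and S: "subspace S" "f ` S \<subseteq> S" "S \<noteq> {0}"
  obtains x c where "x \<in> S" "norm x = 1" "f x = c *\<^sub>R x"
proof -
  let ?K = "sphere 0 1 \<inter> S"
  have "compact ?K"
    using S(1) by (intro compact_Int_closed closed_subspace) auto
  moreover have "?K \<noteq> {}"
  proof -
    obtain z where z: "z \<in> S" "z \<noteq> 0" using S subspace_0 by blast
    then have "z /\<^sub>R norm z \<in> ?K" using S(1) by (simp add: subspace_scale)
    then show ?thesis by blast
  qed
  moreover have "continuous_on ?K (\<lambda>x. x \<bullet> f x)"
    by (intro continuous_intros linear_continuous_on linear_conv_bounded_linear[THEN iffD1] lin)
  ultimately obtain x where x: "x \<in> ?K" "\<And>y. y \<in> ?K \<Longrightarrow> y \<bullet> f y \<le> x \<bullet> f x"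
    using continuous_attains_sup[of ?K "\<lambda>x. x \<bullet> f x"] by blast
  define c where "c = x \<bullet> f x"
  define q where "q y = c * (y \<bullet> y) - y \<bullet> f y" for y
  have xx: "x \<bullet> x = 1" using x(1) by (simp add: norm_eq_1)
  have q_nonneg: "q y \<ge> 0" if "y \<in> S" for y
  proof (cases "y = 0")
    case True
    then show ?thesis using lin by (simp add: q_def linear_0)
  next
    case False
    let ?u = "y /\<^sub>R norm y"
    have "norm ?u = 1" "?u \<in> S" using False that S(1) by (simp_all add: subspace_scale)
    then have "?u \<bullet> f ?u \<le> c" using x(2)[of ?u] unfolding c_def by simp
    moreover have "?u \<bullet> f ?u = (y \<bullet> f y) / (y \<bullet> y)"
      using linear_scale[OF lin, of "inverse (norm y)" y]
      by (simp add: dot_square_norm power2_eq_square divide_inverse)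
    ultimately have "(y \<bullet> f y) / (y \<bullet> y) \<le> c" by simp
    then show ?thesis using False by (simp add: q_def divide_le_eq)
  qed
  define w where "w = c *\<^sub>R x - f x"
  define a where "a = w \<bullet> w"
  have wS: "w \<in> S" using S x by (auto simp: w_def intro!: subspace_diff subspace_scale)
  have expand: "q (x + t *\<^sub>R w) = 2 * t * a + t\<^sup>2 * q w" for t
  proof -
    have "x \<bullet> f w = w \<bullet> f x" using adj[of x w] by (simp add: inner_commute)
    moreover have "x \<bullet> f x = c" by (simp add: c_def)
    ultimately have "q (x + t *\<^sub>R w) = 2 * t * (c * (w \<bullet> x) - w \<bullet> f x) + t\<^sup>2 * q w"
      using lin xx
      by (simp add: q_def linear_add linear_scale inner_add_left inner_add_right
          power2_eq_square inner_commute[of x w] algebra_simps)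
    also have "c * (w \<bullet> x) - w \<bullet> f x = a"
      unfolding a_def by (subst (4) w_def) (simp add: inner_diff_right)
    finally show ?thesis .
  qed
  have "a = 0"
  proof (rule ccontr)
    assume "a \<noteq> 0"
    then have a: "a > 0" by (simp add: a_def)
    let ?b = "q w"
    have b: "?b \<ge> 0" using q_nonneg wS .
    \<comment> \<open>the step length is small enough for the linear term to dominate the quadratic one\<close>
    have "x + (- a / (?b + 1)) *\<^sub>R w \<in> S" using S(1) x(1) wS by (intro subspace_add subspace_scale) auto
    then have "0 \<le> 2 * (- a / (?b + 1)) * a + (- a / (?b + 1))\<^sup>2 * ?b"
      using q_nonneg expand by metis
    also have "\<dots> = - (a\<^sup>2 * (?b + 2)) / (?b + 1)\<^sup>2"
      using b by (simp add: divide_simps power2_eq_square) (simp add: algebra_simps)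
    also have "\<dots> < 0" using a b by (simp add: divide_neg_pos)
    finally show False by simp
  qed
  then have "f x = c *\<^sub>R x" by (simp add: a_def w_def)
  then show ?thesis using that x(1) by auto
qed

text \<open>Invariant subspaces are the right generality for the induction on the dimension: the
  orthogonal complement of an eigenvector within \<open>S\<close> is invariant again.\<close>

lemma self_adjoint_orthonormal_eigenbasis:
  fixes f :: "'a::euclidean_space \<Rightarrow> 'a"
  assumes lin: "linear f" and adj: "\<And>x y. f x \<bullet> y = x \<bullet> f y"
  shows "subspace S \<Longrightarrow> f ` S \<subseteq> S \<Longrightarrow>
    \<exists>B. pairwise orthogonal B \<and> (\<forall>b\<in>B. norm b = 1 \<and> (\<exists>c. f b = c *\<^sub>R b)) \<and> span B = S"
proof (induction "dim S" arbitrary: S rule: less_induct)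
  case less
  show ?case
  proof (cases "S = {0}")
    case True
    then show ?thesis by (intro exI[of _ "{}"]) auto
  next
    case False
    obtain x c where x: "x \<in> S" "norm x = 1" "f x = c *\<^sub>R x"
      using self_adjoint_eigenvector[OF lin adj less.prems False] .
    have xx: "x \<bullet> x = 1" using x by (simp add: norm_eq_1)
    define T where "T = S \<inter> {y. x \<bullet> y = 0}"
    have T: "subspace T" unfolding T_def
      using less.prems(1) subspace_hyperplane by (rule subspace_inter)
    have inv: "f ` T \<subseteq> T"
    proof clarify
      fix y assume y: "y \<in> T"
      then have "x \<bullet> f y = 0" using adj[of x y] by (simp add: x T_def)
      then show "f y \<in> T" using y less.prems(2) by (auto simp: T_def)
    qed
    have "T \<subseteq> S" "x \<notin> T" using xx by (auto simp: T_def)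
    then have "T \<subset> S" using x(1) by blast
    then have "dim T < dim S"
      using T less.prems(1) by (intro dim_psubset) (simp add: span_eq_iff[THEN iffD2])
    then obtain B where B: "pairwise orthogonal B"
      "\<forall>b\<in>B. norm b = 1 \<and> (\<exists>c. f b = c *\<^sub>R b)" "span B = T"
      using less.hyps[OF _ T inv] by blast
    have BT: "B \<subseteq> T" using B(3) span_superset by blast
    have "pairwise orthogonal (insert x B)"
      using B(1) BT by (auto simp: pairwise_insert orthogonal_def T_def inner_commute)
    moreover have "span (insert x B) = S"
    proof
      show "span (insert x B) \<subseteq> S"
        using BT x(1) less.prems(1) by (intro span_minimal) (auto simp: T_def)
      show "S \<subseteq> span (insert x B)"
      proof
        fix y assume "y \<in> S"
        then have "y - (x \<bullet> y) *\<^sub>R x \<in> T"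
          using x(1) xx less.prems(1)
          by (auto simp: T_def inner_diff_right intro!: subspace_diff subspace_scale)
        then show "y \<in> span (insert x B)" using B(3) by (auto simp: span_insert)
      qed
    qed
    ultimately show ?thesis using B(2) x by (intro exI[of _ "insert x B"]) auto
  qed
qed

lemma matrix_mult_diag_matrix: "(Q ** diag_matrix d) $ i $ j = Q $ i $ j * d $ j"
  by (simp add: matrix_matrix_mult_def diag_matrix_def if_distrib cong: if_cong)

lemma diag_matrix_mult_matrix: "(diag_matrix d ** Q) $ i $ j = d $ i * Q $ i $ j"
  by (simp add: matrix_matrix_mult_def diag_matrix_def if_distrib[of "\<lambda>x. x * _"] cong: if_cong)

theorem spectral_decomposition_exists:
  fixes X :: "real^'n^'n"
  assumes "X \<in> sym_matrices"
  obtains Q d where "spectral_decomposition X Q d"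
proof -
  have "(X *v x) \<bullet> y = x \<bullet> (X *v y)" for x y
    using assms dot_lmul_matrix[of x X y] transpose_matrix_vector[of X x]
    by (simp add: sym_matrices_def)
  then obtain B where B: "pairwise orthogonal B"
      "\<forall>b\<in>B. norm b = 1 \<and> (\<exists>c. X *v b = c *\<^sub>R b)" "span B = (UNIV :: (real^'n) set)"
    using self_adjoint_orthonormal_eigenbasis[of "(*v) X" UNIV] by auto
  have "0 \<notin> B" using B(2) by force
  then have ind: "independent B" using B(1) pairwise_orthogonal_independent by blast
  then have "card B = CARD('n)"
    using dim_eq_card[of B UNIV] B(3) by simp
  moreover have "finite B" using ind by (rule independent_imp_finite)
  ultimately obtain b where b: "bij_betw b (UNIV :: 'n set) B"
    using finite_same_card_bij[of "UNIV :: 'n set" B] by auto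
  have bB: "b i \<in> B" for i using b by (auto simp: bij_betw_def)
  have "\<forall>i. \<exists>a. X *v b i = a *\<^sub>R b i" using B(2) bB by blast
  from choice[OF this] obtain c where c: "\<forall>i. X *v b i = c i *\<^sub>R b i" ..
  define Q :: "real^'n^'n" where "Q = (\<chi> i j. b j $ i)"
  define d where "d = (\<chi> i. c i)"
  have col: "column j Q = b j" for j by (simp add: column_def Q_def vec_eq_iff)
  have "orthogonal (b i) (b j)" if "i \<noteq> j" for i j
  proof -
    have "b i \<noteq> b j" using b that by (auto simp: bij_betw_def inj_def)
    then show ?thesis using B(1) bB by (simp add: pairwise_def)
  qed
  then have Q: "orthogonal_matrix Q"
    using B(2) bB by (simp add: orthogonal_matrix_orthonormal_columns col)
  have "X ** Q = Q ** diag_matrix d"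
  proof -
    have "(X ** Q) $ i $ j = Q $ i $ j * d $ j" for i j
      using c[rule_format, of j]
      by (simp add: vec_eq_iff matrix_matrix_mult_def matrix_vector_mult_def Q_def d_def mult.commute)
    then show ?thesis by (simp add: vec_eq_iff matrix_mult_diag_matrix)
  qed
  then have "X = Q ** diag_matrix d ** transpose Q"
    using Q by (metis matrix_mul_assoc matrix_mul_rid orthogonal_matrix_def)
  then show ?thesis using that Q by (auto simp: spectral_decomposition_def)
qed

lemma spectral_decomposition_sym:
  assumes "spectral_decomposition X Q d"
  shows "X \<in> sym_matrices"
proof -
  have "transpose (diag_matrix d) = diag_matrix d"
    by (auto simp: transpose_def diag_matrix_def vec_eq_iff)
  then show ?thesis
    using assms by (simp add: spectral_decomposition_def sym_matrices_def matrix_transpose_mul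
        matrix_mul_assoc)
qed

section \<open>Algebra of matrices with common eigenvectors\<close>

text \<open>For orthogonal \<open>Q\<close> the map \<open>d \<mapsto> Q Diag(d) Q\<^sup>T\<close> is a homomorphism of unital algebras;
  polynomial and rational expressions in a matrix are evaluated with the following lemmas.\<close>

lemma conjugate_diag_nth:
  fixes Q :: "real^'n^'n"
  shows "(Q ** diag_matrix d ** transpose Q) $ i $ j = (\<Sum>k\<in>UNIV. Q $ i $ k * d $ k * Q $ j $ k)"
  unfolding matrix_matrix_mult_def[of "Q ** diag_matrix d"]
  by (simp add: matrix_mult_diag_matrix transpose_def)

lemma conjugate_diag_add:
  fixes Q :: "real^'n^'n"
  shows "Q ** diag_matrix d ** transpose Q + Q ** diag_matrix e ** transpose Q =
   Q ** diag_matrix (d + e) ** transpose Q"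
  by (simp add: vec_eq_iff conjugate_diag_nth algebra_simps sum.distrib)

lemma conjugate_diag_scaleR:
  fixes Q :: "real^'n^'n"
  shows "c *\<^sub>R (Q ** diag_matrix d ** transpose Q) = Q ** diag_matrix (c *\<^sub>R d) ** transpose Q"
  by (simp add: vec_eq_iff conjugate_diag_nth sum_distrib_left mult_ac)

lemma conjugate_diag_uminus:
  fixes Q :: "real^'n^'n"
  shows "- (Q ** diag_matrix d ** transpose Q) = Q ** diag_matrix (- d) ** transpose Q"
  using conjugate_diag_scaleR[of "-1" Q d] by simp

lemma conjugate_diag_mult:
  fixes Q :: "real^'n^'n"
  assumes "orthogonal_matrix Q"
  shows "(Q ** diag_matrix d ** transpose Q) ** (Q ** diag_matrix e ** transpose Q) =
         Q ** diag_matrix (\<chi> i. d $ i * e $ i) ** transpose Q"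
proof -
  have "(Q ** diag_matrix d ** transpose Q) ** (Q ** diag_matrix e ** transpose Q) =
      Q ** diag_matrix d ** (transpose Q ** Q) ** diag_matrix e ** transpose Q"
    by (simp add: matrix_mul_assoc)
  also have "\<dots> = Q ** (diag_matrix d ** diag_matrix e) ** transpose Q"
    using assms by (simp add: orthogonal_matrix_def matrix_mul_assoc)
  also have "diag_matrix d ** diag_matrix e = diag_matrix (\<chi> i. d $ i * e $ i)"
    by (simp add: vec_eq_iff matrix_mult_diag_matrix) (simp add: diag_matrix_def)
  finally show ?thesis .
qed

lemma conjugate_diag_one:
  fixes Q :: "real^'n^'n"
  assumes "orthogonal_matrix Q"
  shows "Q ** diag_matrix (\<chi> i. 1) ** transpose Q = mat 1"
proof -
  have "diag_matrix (\<chi> i. 1) = (mat 1 :: real^'n^'n)"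
    by (simp add: diag_matrix_def mat_def vec_eq_iff)
  then show ?thesis using assms by (simp add: orthogonal_matrix_def)
qed

lemma matrix_inv_eqI:
  fixes A B :: "real^'n^'n"
  assumes "A ** B = mat 1" and "B ** A = mat 1"
  shows "matrix_inv A = B"
  unfolding matrix_inv_def
proof (rule some_equality)
  fix C assume C: "A ** C = mat 1 \<and> C ** A = mat 1"
  have "C = C ** (A ** B)" using assms by simp
  also have "\<dots> = B" using C by (simp add: matrix_mul_assoc)
  finally show "C = B" .
qed (use assms in blast)

lemma conjugate_diag_inverse:
  fixes Q :: "real^'n^'n"
  assumes "orthogonal_matrix Q" and "\<And>i. d $ i \<noteq> 0"
  shows "matrix_inv (Q ** diag_matrix d ** transpose Q) =
         Q ** diag_matrix (\<chi> i. inverse (d $ i)) ** transpose Q"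
proof (rule matrix_inv_eqI)
  show "(Q ** diag_matrix d ** transpose Q) **
      (Q ** diag_matrix (\<chi> i. inverse (d $ i)) ** transpose Q) = mat 1"
    and "(Q ** diag_matrix (\<chi> i. inverse (d $ i)) ** transpose Q) **
      (Q ** diag_matrix d ** transpose Q) = mat 1"
    using assms by (simp_all add: conjugate_diag_mult conjugate_diag_one)
qed

section \<open>Eigenvalues as roots of the characteristic polynomial\<close>

text \<open>Evaluating the polynomial determinant at a point commutes with the determinant, so the
  identity can be checked pointwise, where it is the invariance of a real determinant under
  orthogonal conjugation.\<close>

lemma char_poly_matrix_spectral:
  fixes X :: "real^'n^'n"
  assumes "spectral_decomposition X Q d"
  shows "char_poly_matrix X = (\<Prod>i\<in>UNIV. [:- (d $ i), 1:])"
proof -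
  have "poly (char_poly_matrix X) x = poly (\<Prod>i\<in>UNIV. [:- (d $ i), 1:]) x" for x
  proof -
    let ?D = "diag_matrix (\<chi> i. x - d $ i)"
    have Q: "orthogonal_matrix Q" and X: "X = Q ** diag_matrix d ** transpose Q"
      using assms by (auto simp: spectral_decomposition_def)
    have "poly (char_poly_matrix X) x = det (x *\<^sub>R mat 1 - X)"
      unfolding char_poly_matrix_def det_def
      by (auto simp: poly_sum poly_prod mat_def intro!: sum.cong prod.cong)
    also have "x *\<^sub>R mat 1 - X = Q ** ?D ** transpose Q"
    proof -
      have "x *\<^sub>R mat 1 - X = x *\<^sub>R (Q ** diag_matrix (\<chi> i. 1) ** transpose Q) + - X"
        using conjugate_diag_one[OF Q] by simp
      also have "\<dots> = Q ** diag_matrix (x *\<^sub>R (\<chi> i. 1) + - d) ** transpose Q"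
        unfolding X conjugate_diag_scaleR conjugate_diag_uminus conjugate_diag_add ..
      also have "x *\<^sub>R (\<chi> i. 1) + - d = (\<chi> i. x - d $ i)" by (simp add: vec_eq_iff)
      finally show ?thesis .
    qed
    also have "det \<dots> = det ?D"
      using det_orthogonal_matrix[OF Q] by (auto simp: det_mul)
    also have "\<dots> = (\<Prod>i\<in>UNIV. x - d $ i)"
      by (subst det_diagonal) (auto simp: diag_matrix_def)
    finally show ?thesis by (simp add: poly_prod)
  qed
  then show ?thesis by (simp add: poly_eq_poly_eq_iff[symmetric] fun_eq_iff)
qed

text \<open>The index runs over exactly the positions of a list of length \<open>CARD('n)\<close>, so the
  default values of list access never occur.\<close>

lemma eigenvalue_nth_range:
  fixes X :: "real^'n^'n"
  assumes "spectral_decomposition X Q d"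
  shows "(\<lambda>j. eigenvalue_nth j X) ` {1..CARD('n)} = range (\<lambda>i. d $ i)"
proof -
  let ?M = "proots (char_poly_matrix X)"
  let ?l = "rev (sorted_list_of_multiset ?M)"
  have M: "?M = image_mset (\<lambda>i. d $ i) (mset_set UNIV)"
    unfolding char_poly_matrix_spectral[OF assms]
    by (subst proots_prod) (auto simp: sum_unfold_sum_mset multiset.map_comp)
  have len: "length ?l = CARD('n)"
    by (metis M length_rev mset_sorted_list_of_multiset size_mset size_image_mset size_mset_set)
  have "(\<lambda>j. eigenvalue_nth j X) ` {1..CARD('n)} = (\<lambda>j. ?l ! (j - 1)) ` Suc ` {0..<length ?l}"
    unfolding eigenvalue_nth_def len by (simp add: atLeastLessThanSuc_atLeastAtMost)
  also have "\<dots> = set ?l"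
  proof -
    have "(\<lambda>j. l ! (j - 1)) ` Suc ` {0..<length l} = set l" for l :: "real list"
      by (simp only: image_image diff_Suc_1) (auto simp: in_set_conv_nth)
    then show ?thesis .
  qed
  also have "\<dots> = range (\<lambda>i. d $ i)" using M by simp
  finally show ?thesis .
qed

section \<open>Functional calculus\<close>

text \<open>If \<open>Q D Q\<^sup>T = P E P\<^sup>T\<close>, then the matrix \<open>R = P\<^sup>T Q\<close> satisfies \<open>R D = E R\<close>, so it has nonzero
  entries only where an entry of \<open>D\<close> agrees with one of \<open>E\<close>; applying \<open>g\<close> to both diagonals
  preserves that relation.\<close>

lemma spectral_function_unique:
  assumes "spectral_decomposition X Q d" and "spectral_decomposition X P e"
  shows "Q ** diag_matrix (\<chi> i. g (d $ i)) ** transpose Q =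
         P ** diag_matrix (\<chi> i. g (e $ i)) ** transpose P"
proof -
  have Q: "Q ** transpose Q = mat 1" "transpose Q ** Q = mat 1"
    and P: "P ** transpose P = mat 1" "transpose P ** P = mat 1"
    and eq: "Q ** diag_matrix d ** transpose Q = P ** diag_matrix e ** transpose P"
    using assms by (auto simp: spectral_decomposition_def orthogonal_matrix_def)
  define R where "R = transpose P ** Q"
  have "R ** diag_matrix d = transpose P ** (Q ** diag_matrix d ** transpose Q) ** Q"
    unfolding R_def by (metis matrix_mul_assoc matrix_mul_rid Q(2))
  also have "\<dots> = diag_matrix e ** R"
    unfolding R_def eq by (metis matrix_mul_assoc matrix_mul_lid P(2))
  finally have "R $ i $ j * d $ j = e $ i * R $ i $ j" for i j
    by (metis matrix_mult_diag_matrix diag_matrix_mult_matrix)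
  then have "R $ i $ j = 0 \<or> d $ j = e $ i" for i j
    by (metis mult.commute mult_cancel_left)
  then have "R $ i $ j * g (d $ j) = g (e $ i) * R $ i $ j" for i j
    by (metis mult.commute mult_zero_left)
  then have R: "R ** diag_matrix (\<chi> i. g (d $ i)) = diag_matrix (\<chi> i. g (e $ i)) ** R"
    by (simp add: vec_eq_iff matrix_mult_diag_matrix diag_matrix_mult_matrix)
  have "Q = P ** R" unfolding R_def by (metis matrix_mul_assoc matrix_mul_lid P(1))
  then have "Q ** diag_matrix (\<chi> i. g (d $ i)) ** transpose Q
      = P ** (R ** diag_matrix (\<chi> i. g (d $ i))) ** transpose Q"
    by (metis matrix_mul_assoc)
  also have "\<dots> = P ** diag_matrix (\<chi> i. g (e $ i)) ** (R ** transpose Q)"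
    unfolding R by (metis matrix_mul_assoc)
  also have "R ** transpose Q = transpose P"
    unfolding R_def by (metis matrix_mul_assoc matrix_mul_rid Q(1))
  finally show ?thesis .
qed

lemma matrix_function_spectral:
  assumes "spectral_decomposition X Q d"
  shows "matrix_function g X = Q ** diag_matrix (\<chi> i. g (d $ i)) ** transpose Q"
  unfolding matrix_function_def
  using assms spectral_function_unique[OF assms] by (intro the_equality) metis+

section \<open>The image of the reparametrisation maps\<close>

definition G_scalar :: "nat \<Rightarrow> real \<Rightarrow> real \<Rightarrow> real \<Rightarrow> real" where
  "G_scalar k \<alpha> \<beta> x =
    (if k = 1 then exp x + \<alpha>
     else if k = 2 then - exp x + \<alpha>
     else if k = 3 then x\<^sup>2 + \<alpha>
     else if k = 4 then - x\<^sup>2 + \<alpha>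
     else if k = 5 then (\<beta> - \<alpha>) / (1 + x\<^sup>2) + \<alpha>
     else if k = 6 then (\<alpha> - \<beta>) / (1 + x\<^sup>2) + \<beta>
     else (\<beta> - \<alpha>) / pi * arctan x + (\<beta> + \<alpha>) / 2)"

text \<open>For \<open>k = 5, 6\<close>, a value is attained at \<open>sqrt (1 / s - 1)\<close>, where \<open>0 < s \<le> 1\<close> is its relative
  distance to the excluded endpoint, because \<open>1 / (1 + x\<^sup>2)\<close> maps the line onto the
  half-open unit interval.\<close>

lemma range_G_scalar:
  assumes "\<alpha> < \<beta>" and k: "k \<in> {1..7}"
  shows "range (G_scalar k \<alpha> \<beta>) = interval_k k \<alpha> \<beta>"
proof -
  have bump: "\<exists>x::real. 1 / (1 + x\<^sup>2) = s" if "0 < s" "s \<le> 1" for s :: real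
    using that by (intro exI[of _ "sqrt (1 / s - 1)"]) simp
  have bump_bounds: "0 < 1 / (1 + x\<^sup>2) \<and> 1 / (1 + x\<^sup>2) \<le> 1" for x :: real
    by (simp add: add_pos_nonneg)
  have "G_scalar k \<alpha> \<beta> x \<in> interval_k k \<alpha> \<beta>" for x
  proof -
    consider "k = 1 \<or> k = 2 \<or> k = 3 \<or> k = 4" | "k = 5 \<or> k = 6" | "k = 7" using k by force
    then show ?thesis
    proof cases
      case 1
      then show ?thesis by (auto simp: G_scalar_def interval_k_def)
    next
      case 2
      define s where "s = 1 / (1 + x\<^sup>2)"
      have "0 < (\<beta> - \<alpha>) * s" "(\<beta> - \<alpha>) * s \<le> (\<beta> - \<alpha>) * 1"
        using bump_bounds[of x] assms(1) unfolding s_def[symmetric]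
        by (auto intro: mult_left_mono)
      moreover have "(\<beta> - \<alpha>) / (1 + x\<^sup>2) = (\<beta> - \<alpha>) * s" "(\<alpha> - \<beta>) / (1 + x\<^sup>2) = - ((\<beta> - \<alpha>) * s)"
        by (simp_all add: s_def minus_divide_left)
      ultimately show ?thesis using 2 by (auto simp: G_scalar_def interval_k_def)
    next
      case 3
      define p where "p = (\<beta> - \<alpha>) / pi * arctan x"
      have "p < (\<beta> - \<alpha>) / pi * (pi / 2)" "(\<beta> - \<alpha>) / pi * (- (pi / 2)) < p"
        unfolding p_def using assms(1) arctan_bounded[of x]
        by (intro mult_strict_left_mono; simp)+
      then have "p < (\<beta> - \<alpha>) / 2" "- ((\<beta> - \<alpha>) / 2) < p" by simp_all
      then show ?thesis using 3
        by (simp add: G_scalar_def interval_k_def p_def[symmetric] del: times_divide_eq_left)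
          (simp add: field_simps)
    qed
  qed
  moreover have "\<exists>x. y = G_scalar k \<alpha> \<beta> x" if y: "y \<in> interval_k k \<alpha> \<beta>" for y
  proof -
    consider "k = 1" | "k = 2" | "k = 3" | "k = 4" | "k = 5" | "k = 6" | "k = 7"
      using k by force
    then show ?thesis
    proof cases
      case 1
      then show ?thesis using y
        by (intro exI[of _ "ln (y - \<alpha>)"]) (simp add: G_scalar_def interval_k_def)
    next
      case 2
      then show ?thesis using y
        by (intro exI[of _ "ln (\<alpha> - y)"]) (simp add: G_scalar_def interval_k_def)
    next
      case 3
      then show ?thesis using y
        by (intro exI[of _ "sqrt (y - \<alpha>)"]) (simp add: G_scalar_def interval_k_def)
    next
      case 4
      then show ?thesis using y
        by (intro exI[of _ "sqrt (\<alpha> - y)"]) (simp add: G_scalar_def interval_k_def)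
    next
      case 5
      then obtain x where "1 / (1 + x\<^sup>2) = (y - \<alpha>) / (\<beta> - \<alpha>)"
        using bump[of "(y - \<alpha>) / (\<beta> - \<alpha>)"] y assms(1) by (auto simp: interval_k_def)
      then have "(\<beta> - \<alpha>) * (1 / (1 + x\<^sup>2)) = y - \<alpha>" using assms(1) by simp
      then show ?thesis using 5 by (intro exI[of _ x]) (simp add: G_scalar_def)
    next
      case 6
      then obtain x where "1 / (1 + x\<^sup>2) = (\<beta> - y) / (\<beta> - \<alpha>)"
        using bump[of "(\<beta> - y) / (\<beta> - \<alpha>)"] y assms(1) by (auto simp: interval_k_def)
      then have "(\<beta> - \<alpha>) * (1 / (1 + x\<^sup>2)) = \<beta> - y" using assms(1) by simp
      then have "(\<alpha> - \<beta>) / (1 + x\<^sup>2) = y - \<beta>"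
        by (metis minus_diff_eq minus_divide_left mult.right_neutral times_divide_eq_right)
      then show ?thesis using 6 by (intro exI[of _ x]) (simp add: G_scalar_def)
    next
      case 7
      define t where "t = (y - (\<beta> + \<alpha>) / 2) * pi / (\<beta> - \<alpha>)"
      have "- (pi / 2) < t" "t < pi / 2"
      proof -
        have "\<bar>y - (\<beta> + \<alpha>) / 2\<bar> < (\<beta> - \<alpha>) / 2"
          using 7 y by (auto simp: interval_k_def abs_less_iff field_simps)
        then have "\<bar>y - (\<beta> + \<alpha>) / 2\<bar> * pi < (\<beta> - \<alpha>) / 2 * pi"
          by (intro mult_strict_right_mono) auto
        then have "\<bar>t\<bar> < pi / 2"
          using assms(1) by (simp add: t_def abs_mult divide_less_eq mult_ac)
        then show "- (pi / 2) < t" "t < pi / 2" by (simp_all add: abs_less_iff)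
      qed
      then have "arctan (tan t) = t" by (rule arctan_tan)
      then show ?thesis using 7 assms(1)
        by (intro exI[of _ "tan t"]) (simp add: G_scalar_def t_def)
    qed
  qed
  ultimately show ?thesis by blast
qed

lemma G_map_spectral:
  assumes sd: "spectral_decomposition X Q d" and k: "k \<in> {1..7}"
  shows "spectral_decomposition (G_map k \<alpha> \<beta> X) Q (\<chi> i. G_scalar k \<alpha> \<beta> (d $ i))"
proof -
  have Q: "orthogonal_matrix Q" and X: "X = Q ** diag_matrix d ** transpose Q"
    using sd by (auto simp: spectral_decomposition_def)
  let ?C = "\<lambda>e. Q ** diag_matrix e ** transpose Q"
  have one: "mat 1 = ?C (\<chi> i. 1)" using conjugate_diag_one[OF Q] by simp
  have sq: "X ** X = ?C (\<chi> i. (d $ i)\<^sup>2)"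
    unfolding X conjugate_diag_mult[OF Q] by (simp add: power2_eq_square)
  have inv: "matrix_inv (mat 1 + X ** X) = ?C (\<chi> i. 1 / (1 + (d $ i)\<^sup>2))"
  proof -
    have "1 + (d $ i)\<^sup>2 \<noteq> 0" for i by (metis sum_power2_eq_zero_iff one_power2 zero_neq_one)
    then show ?thesis
      unfolding sq one conjugate_diag_add
      by (subst conjugate_diag_inverse[OF Q]) (simp_all add: divide_inverse)
  qed
  note calculus = matrix_function_spectral[OF sd] conjugate_diag_add conjugate_diag_scaleR
    conjugate_diag_uminus sq
  consider "k = 1" | "k = 2" | "k = 3" | "k = 4" | "k = 5" | "k = 6" | "k = 7"
    using k by force
  \<comment> \<open>the homomorphism laws produce a diagonal \<open>e\<close> whose form differs with \<open>k\<close>; only its entries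
    are compared with the scalar function\<close>
  then have "\<exists>e. G_map k \<alpha> \<beta> X = ?C e \<and> (\<forall>i. e $ i = G_scalar k \<alpha> \<beta> (d $ i))"
    by cases (simp_all only: G_map_def inv, simp_all only: calculus one,
        auto simp: G_scalar_def intro!: exI)
  then have "G_map k \<alpha> \<beta> X = ?C (\<chi> i. G_scalar k \<alpha> \<beta> (d $ i))"
    by (metis vec_lambda_unique)
  then show ?thesis using Q by (simp add: spectral_decomposition_def)
qed

text \<open>The matrix map is onto the feasible set because surjectivity can be arranged on each
  eigenvalue separately while the eigenvectors are kept.\<close>

theorem G_map_image_sym_matrices:
  fixes \<alpha> \<beta> :: real
  assumes "\<alpha> < \<beta>" and k: "k \<in> {1..7}"
  shows "G_map k \<alpha> \<beta> ` sym_matrices =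
    {X :: real^'n^'n. X \<in> sym_matrices \<and>
       (\<forall>j\<in>{1..CARD('n)}. eigenvalue_nth j X \<in> interval_k k \<alpha> \<beta>)}" (is "_ = ?feasible")
proof -
  note range = range_G_scalar[OF assms]
  have feasible_iff: "X \<in> ?feasible \<longleftrightarrow> (\<forall>i. d $ i \<in> interval_k k \<alpha> \<beta>)"
    if "spectral_decomposition X Q d" for X :: "real^'n^'n" and Q d
  proof -
    have "(\<forall>j\<in>{1..CARD('n)}. eigenvalue_nth j X \<in> interval_k k \<alpha> \<beta>) \<longleftrightarrow>
        (\<lambda>j. eigenvalue_nth j X) ` {1..CARD('n)} \<subseteq> interval_k k \<alpha> \<beta>" by blast
    then show ?thesis
      unfolding eigenvalue_nth_range[OF that] using spectral_decomposition_sym[OF that] by blast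
  qed
  show ?thesis
  proof (intro equalityI subsetI)
    fix X :: "real^'n^'n" assume "X \<in> G_map k \<alpha> \<beta> ` sym_matrices"
    then obtain U where U: "U \<in> sym_matrices" "X = G_map k \<alpha> \<beta> U" by blast
    obtain Q d where "spectral_decomposition U Q d"
      using spectral_decomposition_exists[OF U(1)] .
    then show "X \<in> ?feasible"
      using feasible_iff[OF G_map_spectral[OF _ k]] range U(2) by auto
  next
    fix X :: "real^'n^'n" assume X: "X \<in> ?feasible"
    then obtain Q d where sd: "spectral_decomposition X Q d"
      using spectral_decomposition_exists by blast
    have "\<forall>i. \<exists>x. d $ i = G_scalar k \<alpha> \<beta> x" using X feasible_iff[OF sd] range by blast
    then obtain e where e: "\<And>i. d $ i = G_scalar k \<alpha> \<beta> (e i)" by metis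
    define U where "U = Q ** diag_matrix (\<chi> i. e i) ** transpose Q"
    have U: "spectral_decomposition U Q (\<chi> i. e i)"
      using sd by (simp add: U_def spectral_decomposition_def)
    have "(\<chi> i. G_scalar k \<alpha> \<beta> ((\<chi> i. e i) $ i)) = d" using e by (simp add: vec_eq_iff)
    then have "G_map k \<alpha> \<beta> U = X"
      using G_map_spectral[OF U k, of \<alpha> \<beta>] sd by (simp add: spectral_decomposition_def)
    then show "X \<in> G_map k \<alpha> \<beta> ` sym_matrices"
      using spectral_decomposition_sym[OF U] by blast
  qed
qed

theorem theorem2:
  fixes F :: "real^'n^'n \<Rightarrow> real"
    and \<alpha> \<beta> :: real
    and k :: nat
    and Xs :: "real^'n^'n"
  assumes "C2_on_subspace sym_matrices F"
    and "\<alpha> < \<beta>"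
    and "k \<in> {1..7}"
    and "is_arg_min F
           (\<lambda>X. X \<in> sym_matrices \<and> (\<forall>j\<in>{1..CARD('n)}. eigenvalue_nth j X \<in> interval_k k \<alpha> \<beta>)) Xs"
  shows "\<exists>Us. is_arg_min (\<lambda>U. F (G_map k \<alpha> \<beta> U)) (\<lambda>U. U \<in> sym_matrices) Us \<and>
              F Xs = F (G_map k \<alpha> \<beta> Us)"
proof -
  let ?feasible = "G_map k \<alpha> \<beta> ` (sym_matrices :: (real^'n^'n) set)"
  have min: "is_arg_min F (\<lambda>X. X \<in> ?feasible) Xs"
    using assms(4) unfolding G_map_image_sym_matrices[OF assms(2,3)] by simp
  then obtain Us where "Us \<in> sym_matrices" "Xs = G_map k \<alpha> \<beta> Us"
    by (auto simp: is_arg_min_def)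
  then show ?thesis using min by (intro exI[of _ Us]) (auto simp: is_arg_min_def)
qed

end
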